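(* Let $C$ be a $2$-torsion free commutative ring with unity, let $A$ be an algebra over $C$, and let $f,g,h:A\to A$ be $C$-linear maps such that $f$ is a Jordan left $\{g,h\}$-derivation of $A$. For $F\in\{f,g,h\}$ define $\widetilde{F}:A[x]\to A[x]$ by $\widetilde{F}\big(\sum_{j=0}^{r}a_jx^j\big)=\sum_{j=0}^{r}F(a_j)x^j$ for $a_j\in A$. Then $\widetilde{f}$ is a Jordan left $\{\widetilde{g},\widetilde{h}\}$-derivation of the $C$-algebra $A[x]$.
   Context: A ring $R$ is $2$-torsion free if $2a=0$ with $a\in R$ implies $a=0$. For an algebra $B$ over $C$ and $C$-linear maps $f,g,h:B\to B$, $f$ is a Jordan left $\{g,h\}$-derivation if $f(ab+ba)=2\big(a\,g(b)+b\,h(a)\big)$ for all $a,b\in B$. $A[x]$ is the polynomial ring over $A$ (with $x$ commuting with the elements of $A$), viewed as a $C$-algebra with coefficientwise scalar multiplication. *)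

theory Defs
  imports Complex_Main "HOL-Library.Poly_Mapping"
begin

text \<open>
  Algebras over a commutative ring with unity are associative, but are required neither to be
  commutative nor to have a unity.
\<close>

locale assoc_algebra = module scale
  for scale :: "'c::comm_ring_1 \<Rightarrow> 'a::ring \<Rightarrow> 'a" +
  assumes scale_mult_left: "scale c x * y = scale c (x * y)"
    and scale_mult_right: "x * scale c y = scale c (x * y)"

locale jordan_left_gh_derivation =
  assoc_algebra scale + f: module_hom scale scale f + g: module_hom scale scale g +
  h: module_hom scale scale h
  for scale :: "'c::comm_ring_1 \<Rightarrow> 'a::ring \<Rightarrow> 'a" and f g h :: "'a \<Rightarrow> 'a" +
  assumes jordan_left: "f (a * b + b * a) = scale 2 (a * g b + b * h a)"

text \<open>
  The polynomial ring \<open>A[x]\<close> over a possibly noncommutative, possibly nonunital ring. The type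
  \<open>'a poly\<close> has a product only for commutative coefficients. The product of the type
  \<open>nat \<Rightarrow>\<^sub>0 'a\<close> of finitely supported functions is the convolution product, and
  \<open>Poly_Mapping.single j a\<close> is the monomial \<open>a x\<^sup>j\<close>.
\<close>

type_synonym 'a nc_poly = "nat \<Rightarrow>\<^sub>0 'a"

definition coeffwise :: "('a::ring \<Rightarrow> 'a) \<Rightarrow> 'a nc_poly \<Rightarrow> 'a nc_poly"
  where "coeffwise F p =
    (\<Sum>j\<in>Poly_Mapping.keys p. Poly_Mapping.single j (F (Poly_Mapping.lookup p j)))"

text \<open>
  \<open>coeffwise\<close> sums over the support only. As soon as \<open>F 0 = 0\<close>, the value does not depend on how
  the polynomial is written as a sum of monomials with distinct exponents.
\<close>

lemma lookup_coeffwise: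
  assumes "F 0 = 0"
  shows "Poly_Mapping.lookup (coeffwise F p) j = F (Poly_Mapping.lookup p j)"
  by (auto simp: coeffwise_def lookup_sum lookup_single when_def assms in_keys_iff
      sum.delta)

lemma coeffwise_sum_monomials:
  assumes "F 0 = 0"
  shows "coeffwise F (\<Sum>j\<le>r. Poly_Mapping.single j (a j)) =
    (\<Sum>j\<le>r. Poly_Mapping.single j (F (a j)))"
  by (rule poly_mapping_eqI)
    (auto simp: lookup_coeffwise[of F, OF assms] lookup_sum lookup_single when_def assms)

definition poly_scale :: "('c \<Rightarrow> 'a::ring \<Rightarrow> 'a) \<Rightarrow> 'c \<Rightarrow> 'a nc_poly \<Rightarrow> 'a nc_poly"
  where "poly_scale scale c = coeffwise (scale c)"

end

theory Submission
  imports Defs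
begin

text \<open>
  Both sides of the Jordan identity on \<open>A[x]\<close> are biadditive, so it suffices to compare them on
  pairs of monomials \<open>a x\<^sup>i\<close>, \<open>b x\<^sup>j\<close>. Since \<open>x\<close> is central, both sides are then monomials of degree
  \<open>i + j\<close>, and their coefficients agree by the identity in \<open>A\<close>.
\<close>

lemma coeffwise_single:
  assumes "F 0 = 0"
  shows "coeffwise F (Poly_Mapping.single j a) = Poly_Mapping.single j (F a)"
  by (rule poly_mapping_eqI) (simp add: lookup_coeffwise assms lookup_single when_def)

lemma coeffwise_add:
  assumes "additive F"
  shows "coeffwise F (p + q) = coeffwise F p + coeffwise F q"
  by (rule poly_mapping_eqI)
    (simp add: lookup_coeffwise additive.zero[OF assms] lookup_add additive.add[OF assms])

text \<open>An element of \<open>'k \<Rightarrow>\<^sub>0 'a\<close> is the finite sum of its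
  monomials over its support, and additive maps commute with finite sums, so they are determined by
  their values on monomials.\<close>

lemma additive_eqI_single:
  fixes \<phi> \<psi> :: "('k \<Rightarrow>\<^sub>0 'a::ab_group_add) \<Rightarrow> 'b::ab_group_add"
  assumes "additive \<phi>" "additive \<psi>"
    and "\<And>k a. \<phi> (Poly_Mapping.single k a) = \<psi> (Poly_Mapping.single k a)"
  shows "\<phi> p = \<psi> p"
proof -
  have "\<phi> (\<Sum>k\<in>Poly_Mapping.keys p. Poly_Mapping.single k (Poly_Mapping.lookup p k)) =
      \<psi> (\<Sum>k\<in>Poly_Mapping.keys p. Poly_Mapping.single k (Poly_Mapping.lookup p k))"
    by (simp add: additive.sum[OF assms(1)] additive.sum[OF assms(2)] assms(3))
  moreover have "(\<Sum>k\<in>Poly_Mapping.keys p. Poly_Mapping.single k (Poly_Mapping.lookup p k)) = p"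
    by (rule poly_mapping_eqI)
      (auto simp: lookup_sum lookup_single when_def in_keys_iff sum.delta)
  ultimately show ?thesis by simp
qed

text \<open>The principle for one argument is applied twice: with \<open>q\<close> fixed it reduces
  \<open>p\<close> to a monomial, and with that monomial fixed it reduces \<open>q\<close>.\<close>

lemma biadditive_eqI_single:
  fixes \<phi> \<psi> :: "('k \<Rightarrow>\<^sub>0 'a::ab_group_add) \<Rightarrow> ('l \<Rightarrow>\<^sub>0 'b::ab_group_add) \<Rightarrow> 'c::ab_group_add"
  assumes "\<And>q. additive (\<lambda>p. \<phi> p q)" "\<And>p. additive (\<phi> p)"
    and "\<And>q. additive (\<lambda>p. \<psi> p q)" "\<And>p. additive (\<psi> p)"
    and "\<And>k a l b. \<phi> (Poly_Mapping.single k a) (Poly_Mapping.single l b) =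
      \<psi> (Poly_Mapping.single k a) (Poly_Mapping.single l b)"
  shows "\<phi> p q = \<psi> p q"
proof (rule additive_eqI_single[of "\<lambda>p. \<phi> p q" "\<lambda>p. \<psi> p q"])
  show "\<phi> (Poly_Mapping.single k a) q = \<psi> (Poly_Mapping.single k a) q" for k a
    by (rule additive_eqI_single) (use assms in auto)
qed (use assms in auto)

lemma (in module_hom) additive: "additive f"
  by unfold_locales (rule add)

lemma (in module) additive_scale: "additive (scale c)"
  by unfold_locales (rule scale_right_distrib)

context assoc_algebra
begin

lemma poly_scale_single:
  "poly_scale scale c (Poly_Mapping.single j a) = Poly_Mapping.single j (scale c a)"
  by (simp add: poly_scale_def coeffwise_single)

lemma poly_scale_add: "poly_scale scale c (p + q) = poly_scale scale c p + poly_scale scale c q"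
  by (simp add: poly_scale_def coeffwise_add additive_scale)

lemma module_poly_scale: "module (poly_scale scale)"
  by unfold_locales
    (auto intro!: poly_mapping_eqI
      simp: lookup_coeffwise poly_scale_def lookup_add scale_right_distrib scale_left_distrib)

text \<open>Comparing coefficients here would mean handling convolution sums. Both laws are
  biadditive, and on monomials they become the corresponding laws of the coefficient
  algebra.\<close>

lemma assoc_algebra_poly_scale: "assoc_algebra (poly_scale scale)"
proof (intro assoc_algebra.intro module_poly_scale assoc_algebra_axioms.intro)
  show "poly_scale scale c p * q = poly_scale scale c (p * q)" for c p q
    by (rule biadditive_eqI_single[of "\<lambda>p q. poly_scale scale c p * q"
          "\<lambda>p q. poly_scale scale c (p * q)"])
      (simp_all add: additive_def poly_scale_add distrib_left distrib_right poly_scale_single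
        mult_single scale_mult_left)
  show "p * poly_scale scale c q = poly_scale scale c (p * q)" for c p q
    by (rule biadditive_eqI_single[of "\<lambda>p q. p * poly_scale scale c q"
          "\<lambda>p q. poly_scale scale c (p * q)"])
      (simp_all add: additive_def poly_scale_add distrib_left distrib_right poly_scale_single
        mult_single scale_mult_right)
qed

text \<open>Supplies the linearity of the three extended maps that the locale demands over the
  polynomial algebra. No products occur, so coefficients can be compared directly.\<close>

lemma module_hom_coeffwise:
  assumes "module_hom scale scale F"
  shows "module_hom (poly_scale scale) (poly_scale scale) (coeffwise F)"
proof -
  interpret F: module_hom scale scale F by fact
  show ?thesis
  proof (intro module_hom.intro module_poly_scale module_hom_axioms.intro)
    show "coeffwise F (p + q) = coeffwise F p + coeffwise F q" for p q
      by (rule coeffwise_add[OF F.additive])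
    show "coeffwise F (poly_scale scale c p) = poly_scale scale c (coeffwise F p)" for c p
      by (rule poly_mapping_eqI) (simp add: poly_scale_def lookup_coeffwise F.zero F.scale)
  qed
qed

end

theorem theorem4p2:
  fixes scale :: "'c::comm_ring_1 \<Rightarrow> 'a::ring \<Rightarrow> 'a"
    and f g h :: "'a \<Rightarrow> 'a"
  assumes two_torsion_free: "\<And>c :: 'c. 2 * c = 0 \<Longrightarrow> c = 0"
    and "jordan_left_gh_derivation scale f g h"
  shows "jordan_left_gh_derivation (poly_scale scale) (coeffwise f) (coeffwise g) (coeffwise h)"
proof -
  interpret jordan_left_gh_derivation scale f g h by fact
  note coeffwise_additive = coeffwise_add[OF f.additive] coeffwise_add[OF g.additive]
    coeffwise_add[OF h.additive]
  note monomial = coeffwise_single[where F = f, OF f.zero] coeffwise_single[where F = g, OF g.zero]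
    coeffwise_single[where F = h, OF h.zero] poly_scale_single mult_single
  have "coeffwise f (p * q + q * p) =
      poly_scale scale 2 (p * coeffwise g q + q * coeffwise h p)" for p q
  proof (rule biadditive_eqI_single[of "\<lambda>p q. coeffwise f (p * q + q * p)"
        "\<lambda>p q. poly_scale scale 2 (p * coeffwise g q + q * coeffwise h p)"])
    fix k l :: nat and a b
    show "coeffwise f (Poly_Mapping.single k a * Poly_Mapping.single l b +
          Poly_Mapping.single l b * Poly_Mapping.single k a) =
        poly_scale scale 2 (Poly_Mapping.single k a * coeffwise g (Poly_Mapping.single l b) +
          Poly_Mapping.single l b * coeffwise h (Poly_Mapping.single k a))"
      \<comment> \<open>The equation \<open>l + k = k + l\<close> expresses that \<open>x\<close> is
        central: it gives both products the same exponent. Reading \<open>single_add\<close>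
        backwards then merges the two monomials on each side into one, so that
        \<open>jordan_left\<close> applies to the coefficient.\<close>
      by (simp add: monomial add.commute[of l k] jordan_left flip: single_add)
  \<comment> \<open>What remains is additivity of both sides in each argument.\<close>
  qed (simp_all add: additive_def coeffwise_additive poly_scale_add distrib_left distrib_right)
  then show ?thesis
    by (intro jordan_left_gh_derivation.intro jordan_left_gh_derivation_axioms.intro
        assoc_algebra_poly_scale module_hom_coeffwise f.module_hom_axioms g.module_hom_axioms
        h.module_hom_axioms)
qed

end
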